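(* Let $W$ be a finite Coxeter group acting on the space $V$ of its Tits representation, and let $w\in W$ be a quasi-Coxeter element. Let $\mathcal{F}(w)=\{\mathrm{Fix}(x): x\in[1,w]\}$. Then the map $$\mathrm{Fix}:[1,w]\to\mathcal{F}(w),\qquad x\mapsto \mathrm{Fix}(x)$$ is an anti-isomorphism between the posets $([1,w],\preceq)$ and $(\mathcal{F}(w),\subseteq)$.
   Context: Let $(W,R)$ be a finite Coxeter system and $T=\bigcup_{g\in W}g^{-1}Rg$ its set of reflections. The reflection length $\ell_T(g)$ is the least $k$ such that $g$ is a product of $k$ elements of $T$; a factorization $g=t_1\cdots t_k$ with $t_i\in T$, $k=\ell_T(g)$, is a reduced decomposition. An element $w$ is quasi-Coxeter if it has a reduced decomposition $w=t_1\cdots t_m$ with $\langle t_1,\dots,t_m\rangle=W$. The absolute order is $x\preceq y$ iff $\ell_T(y)=\ell_T(x)+\ell_T(x^{-1}y)$, and $[1,w]=\{x\in W:x\preceq w\}$. $V$ is the real vector space (of dimension $|R|$, with $W$-invariant inner product) on which $W$ acts by the Tits (geometric) representation, elements of $T$ acting as orthogonal reflections. For $x\in W$, $\mathrm{Fix}(x)=\{v\in V: x(v)=v\}$. An anti-isomorphism of posets is an order-reversing bijection whose inverse is order-reversing. *)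

theory Defs
  imports "HOL-Analysis.Analysis" "HOL-Algebra.Generated_Groups"
begin

section \<open>Coxeter systems\<close>

text \<open>Generators are indexed by an arbitrary subset \<open>I\<close> of a finite type, so that rank \<open>0\<close> is
  included; the generating set is \<open>R = s ` I\<close>. The entry \<open>m i j = 0\<close> encodes \<open>m(i,j) = \<infinity>\<close>.\<close>

definition coxeter_matrix :: "'n set \<Rightarrow> ('n \<Rightarrow> 'n \<Rightarrow> nat) \<Rightarrow> bool" where
  "coxeter_matrix I m \<longleftrightarrow>
     (\<forall>i\<in>I. m i i = 1) \<and>
     (\<forall>i\<in>I. \<forall>j\<in>I. m i j = m j i) \<and>
     (\<forall>i\<in>I. \<forall>j\<in>I. i \<noteq> j \<longrightarrow> m i j \<noteq> 1)"

text \<open>The congruence on words over \<open>I\<close> generated by the relations \<open>(i j)\<^bsup>m(i,j)\<^esup> = 1\<close>. As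
  \<open>i i = 1\<close> is among them, the quotient of the free monoid is already the group presented by
  these relations. For \<open>m i j = 0\<close> the relator is the empty word, i.e. there is no relation.\<close>

inductive coxeter_equiv :: "'n set \<Rightarrow> ('n \<Rightarrow> 'n \<Rightarrow> nat) \<Rightarrow> 'n list \<Rightarrow> 'n list \<Rightarrow> bool"
  for I m where
  relator: "\<lbrakk>i \<in> I; j \<in> I; u \<in> lists I; v \<in> lists I\<rbrakk> \<Longrightarrow>
      coxeter_equiv I m (u @ concat (replicate (m i j) [i, j]) @ v) (u @ v)"
| refl: "u \<in> lists I \<Longrightarrow> coxeter_equiv I m u u"
| sym: "coxeter_equiv I m u v \<Longrightarrow> coxeter_equiv I m v u"
| trans: "\<lbrakk>coxeter_equiv I m u v; coxeter_equiv I m v x\<rbrakk> \<Longrightarrow> coxeter_equiv I m u x"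

definition list_mult :: "('a, 'b) monoid_scheme \<Rightarrow> 'a list \<Rightarrow> 'a" where
  "list_mult G xs = foldr (\<otimes>\<^bsub>G\<^esub>) xs \<one>\<^bsub>G\<^esub>"

text \<open>\<open>G = \<langle>R | (s\<^sub>i s\<^sub>j)\<^bsup>m(i,j)\<^esup> = 1\<rangle>\<close>: the \<open>s i\<close> generate \<open>G\<close>, and
  two words have the same value in \<open>G\<close> exactly if the relations force this.\<close>

definition coxeter_system ::
  "('a, 'b) monoid_scheme \<Rightarrow> 'n set \<Rightarrow> ('n \<Rightarrow> 'a) \<Rightarrow> ('n \<Rightarrow> 'n \<Rightarrow> nat) \<Rightarrow> bool" where
  "coxeter_system G I s m \<longleftrightarrow>
     group G \<and> coxeter_matrix I m \<and>
     inj_on s I \<and> s ` I \<subseteq> carrier G \<and> generate G (s ` I) = carrier G \<and>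
     (\<forall>u\<in>lists I. \<forall>v\<in>lists I.
        list_mult G (map s u) = list_mult G (map s v) \<longleftrightarrow> coxeter_equiv I m u v)"


section \<open>Reflections, reflection length and the absolute order\<close>

definition reflections :: "('a, 'b) monoid_scheme \<Rightarrow> 'a set \<Rightarrow> 'a set" where
  "reflections G R = (\<Union>g\<in>carrier G. (\<lambda>r. inv\<^bsub>G\<^esub> g \<otimes>\<^bsub>G\<^esub> r \<otimes>\<^bsub>G\<^esub> g) ` R)"

definition reflection_length :: "('a, 'b) monoid_scheme \<Rightarrow> 'a set \<Rightarrow> 'a \<Rightarrow> nat" where
  "reflection_length G R g =
     (LEAST k. \<exists>ts. set ts \<subseteq> reflections G R \<and> length ts = k \<and> list_mult G ts = g)"

definition reduced_decomposition :: "('a, 'b) monoid_scheme \<Rightarrow> 'a set \<Rightarrow> 'a \<Rightarrow> 'a list \<Rightarrow> bool" where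
  "reduced_decomposition G R g ts \<longleftrightarrow>
     set ts \<subseteq> reflections G R \<and> list_mult G ts = g \<and> length ts = reflection_length G R g"

definition quasi_coxeter :: "('a, 'b) monoid_scheme \<Rightarrow> 'a set \<Rightarrow> 'a \<Rightarrow> bool" where
  "quasi_coxeter G R w \<longleftrightarrow>
     w \<in> carrier G \<and>
     (\<exists>ts. reduced_decomposition G R w ts \<and> generate G (set ts) = carrier G)"

definition absolute_le :: "('a, 'b) monoid_scheme \<Rightarrow> 'a set \<Rightarrow> 'a \<Rightarrow> 'a \<Rightarrow> bool" where
  "absolute_le G R x y \<longleftrightarrow>
     reflection_length G R y = reflection_length G R x + reflection_length G R (inv\<^bsub>G\<^esub> x \<otimes>\<^bsub>G\<^esub> y)"

definition absolute_interval :: "('a, 'b) monoid_scheme \<Rightarrow> 'a set \<Rightarrow> 'a \<Rightarrow> 'a set" where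
  "absolute_interval G R w = {x \<in> carrier G. absolute_le G R x w}"


section \<open>The Tits representation\<close>

text \<open>The space \<open>V\<close> with basis \<open>(e\<^sub>i)\<close> for \<open>i \<in> I\<close>, as a coordinate subspace.\<close>

definition tits_space :: "'n set \<Rightarrow> (real ^ 'n::finite) set" where
  "tits_space I = {v. \<forall>i. i \<notin> I \<longrightarrow> v $ i = 0}"

text \<open>\<open>B(e\<^sub>i, e\<^sub>j) = - cos (\<pi> / m(i,j))\<close>. Since \<open>pi / 0 = 0\<close>, the
  usual convention \<open>B(e\<^sub>i, e\<^sub>j) = -1\<close> for \<open>m(i,j) = \<infinity>\<close> is covered.\<close>

definition tits_form ::
  "'n set \<Rightarrow> ('n \<Rightarrow> 'n \<Rightarrow> nat) \<Rightarrow> real ^ 'n::finite \<Rightarrow> real ^ 'n \<Rightarrow> real" where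
  "tits_form I m u v = (\<Sum>i\<in>I. \<Sum>j\<in>I. - cos (pi / real (m i j)) * u $ i * v $ j)"

definition simple_reflection ::
  "'n set \<Rightarrow> ('n \<Rightarrow> 'n \<Rightarrow> nat) \<Rightarrow> 'n \<Rightarrow> real ^ 'n::finite \<Rightarrow> real ^ 'n" where
  "simple_reflection I m i v = v - (2 * tits_form I m (axis i 1) v) *\<^sub>R axis i 1"

text \<open>An element acts through an arbitrary word in the generators representing it. Independence of
  the word, and that this is the homomorphism sending \<open>s i\<close> to \<open>simple_reflection I m i\<close>, is
  shown below.\<close>

definition tits_rep ::
  "('a, 'b) monoid_scheme \<Rightarrow> 'n set \<Rightarrow> ('n \<Rightarrow> 'a) \<Rightarrow> ('n \<Rightarrow> 'n \<Rightarrow> nat) \<Rightarrow>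
     'a \<Rightarrow> real ^ 'n::finite \<Rightarrow> real ^ 'n" where
  "tits_rep G I s m g =
     foldr (simple_reflection I m) (SOME u. u \<in> lists I \<and> list_mult G (map s u) = g)"

definition Fix ::
  "('a, 'b) monoid_scheme \<Rightarrow> 'n set \<Rightarrow> ('n \<Rightarrow> 'a) \<Rightarrow> ('n \<Rightarrow> 'n \<Rightarrow> nat) \<Rightarrow>
     'a \<Rightarrow> (real ^ 'n::finite) set" where
  "Fix G I s m x = {v \<in> tits_space I. tits_rep G I s m x v = v}"


section \<open>Anti-isomorphisms of posets\<close>

definition poset_on :: "'a set \<Rightarrow> ('a \<Rightarrow> 'a \<Rightarrow> bool) \<Rightarrow> bool" where
  "poset_on A leA \<longleftrightarrow> reflp_on A leA \<and> transp_on A leA \<and> antisymp_on A leA"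

definition poset_anti_isomorphism ::
  "'a set \<Rightarrow> ('a \<Rightarrow> 'a \<Rightarrow> bool) \<Rightarrow> 'b set \<Rightarrow> ('b \<Rightarrow> 'b \<Rightarrow> bool) \<Rightarrow> ('a \<Rightarrow> 'b) \<Rightarrow> bool" where
  "poset_anti_isomorphism A leA B leB f \<longleftrightarrow>
     poset_on A leA \<and> poset_on B leB \<and> bij_betw f A B \<and>
     monotone_on A leA (\<lambda>a b. leB b a) f \<and>
     monotone_on B leB (\<lambda>a b. leA b a) (inv_into A f)"


section \<open>Well-definedness of the Tits representation\<close>

lemma tits_form_axis:
  assumes "i \<in> I"
  shows "tits_form I m (axis i 1) v = (\<Sum>j\<in>I. - cos (pi / real (m i j)) * v $ j)"
proof -
  have "tits_form I m (axis i 1) v =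
      (\<Sum>k\<in>I. if k = i then (\<Sum>j\<in>I. - cos (pi / real (m i j)) * v $ j) else 0)"
    unfolding tits_form_def by (rule sum.cong) (auto simp: axis_def)
  with assms show ?thesis by (simp add: finite_subset[OF subset_UNIV])
qed

lemma tits_form_axis_axis:
  assumes "i \<in> I" "j \<in> I"
  shows "tits_form I m (axis i 1) (axis j 1) = - cos (pi / real (m i j))"
proof -
  have "tits_form I m (axis i 1) (axis j 1) =
      (\<Sum>k\<in>I. if k = j then - cos (pi / real (m i j)) else 0)"
    unfolding tits_form_axis[OF assms(1)] by (rule sum.cong) (auto simp: axis_def)
  with assms show ?thesis by (simp add: finite_subset[OF subset_UNIV])
qed

lemma tits_form_add_right: "tits_form I m u (v + w) = tits_form I m u v + tits_form I m u w"
  by (simp add: tits_form_def algebra_simps sum.distrib sum_subtractf sum_negf)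

lemma tits_form_scaleR_right: "tits_form I m u (c *\<^sub>R v) = c * tits_form I m u v"
  by (simp add: tits_form_def sum_distrib_left mult_ac)

lemma tits_form_diff_right: "tits_form I m u (v - w) = tits_form I m u v - tits_form I m u w"
  using tits_form_add_right[of I m u v "(-1) *\<^sub>R w"] tits_form_scaleR_right[of I m u "-1" w]
  by simp

lemma linear_simple_reflection: "linear (simple_reflection I m i)"
  by (rule linearI)
     (simp_all add: simple_reflection_def tits_form_add_right tits_form_scaleR_right algebra_simps)

lemma simple_reflection_tits_space:
  "\<lbrakk>i \<in> I; v \<in> tits_space I\<rbrakk> \<Longrightarrow> simple_reflection I m i v \<in> tits_space I"
  by (auto simp: tits_space_def simple_reflection_def axis_def)

lemma simple_reflection_involution:
  assumes "coxeter_matrix I m" "i \<in> I"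
  shows "simple_reflection I m i (simple_reflection I m i v) = v"
proof -
  have "m i i = 1" using assms by (auto simp: coxeter_matrix_def)
  with assms have "tits_form I m (axis i 1) (axis i 1) = 1"
    by (simp add: tits_form_axis_axis)
  then show ?thesis
    by (simp add: simple_reflection_def tits_form_diff_right tits_form_scaleR_right algebra_simps)
qed

lemma dihedral_power:
  assumes cm: "coxeter_matrix I m" and ij: "i \<in> I" "j \<in> I" "i \<noteq> j" and m: "m i j \<noteq> 0"
  defines "t \<equiv> pi / real (m i j)"
  defines "S \<equiv> \<lambda>k::nat. sin (real k * t) / sin t"
  shows "((simple_reflection I m i \<circ> simple_reflection I m j) ^^ k) v =
    v - (S k * (2 * tits_form I m (axis i 1) v * S k + 2 * tits_form I m (axis j 1) v * S (k + 1)))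
          *\<^sub>R axis i 1
      - (S k * (2 * tits_form I m (axis j 1) v * S k
           + 2 * tits_form I m (axis i 1) v * (2 * cos t * S k - S (k + 1)))) *\<^sub>R axis j 1"
proof (induction k)
  case 0
  then show ?case by (simp add: S_def)
next
  case (Suc k)
  let ?p = "tits_form I m (axis i 1) v" and ?q = "tits_form I m (axis j 1) v"
  have mji: "m j i = m i j" "m i i = 1" "m j j = 1" "m i j \<noteq> 1"
    using cm ij by (auto simp: coxeter_matrix_def)
  have "0 < t" "t < pi"
    using m mji by (auto simp: t_def divide_less_eq)
  then have st: "sin t > 0" by (rule sin_gt_zero)
  have B: "tits_form I m (axis i 1) (axis i 1) = 1" "tits_form I m (axis j 1) (axis j 1) = 1"
     "tits_form I m (axis i 1) (axis j 1) = - cos t" "tits_form I m (axis j 1) (axis i 1) = - cos t"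
    using ij mji by (simp_all add: tits_form_axis_axis t_def)
  define a b c where "a = S k" and "b = S (k + 1)" and "c = cos t"
  have rec: "S (k + 2) = 2 * c * b - a"
  proof -
    have "sin (real (k + 2) * t) + sin (real k * t) = 2 * cos t * sin (real (k + 1) * t)"
      using sin_add[of "real (k+1) * t" t] sin_diff[of "real (k+1) * t" t]
      by (simp add: algebra_simps)
    then show ?thesis using st by (simp add: S_def a_def b_def c_def field_simps)
  qed
  have q: "a\<^sup>2 + b\<^sup>2 = 2 * c * a * b + 1"
  proof -
    let ?x = "real k * t"
    have b': "b = (sin ?x * cos t + cos ?x * sin t) / sin t"
      by (simp add: b_def S_def distrib_right sin_add)
    have "(sin ?x)\<^sup>2 + (sin ?x * cos t + cos ?x * sin t)\<^sup>2
        = 2 * cos t * sin ?x * (sin ?x * cos t + cos ?x * sin t) + (sin t)\<^sup>2"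
      using sin_cos_squared_add[of ?x] sin_cos_squared_add[of t] by algebra
    then show ?thesis using st
      by (simp add: a_def S_def b' c_def power_divide power2_eq_square divide_simps)
  qed
  let ?A = "a * (2 * ?p * a + 2 * ?q * b)"
  let ?B = "a * (2 * ?q * a + 2 * ?p * (2 * c * a - b))"
  have step_j: "simple_reflection I m j (v - x *\<^sub>R axis i 1 - y *\<^sub>R axis j 1)
      = v - x *\<^sub>R axis i 1 - (y + 2 * (?q + c * x - y)) *\<^sub>R axis j 1" for x y
  proof -
    have "tits_form I m (axis j 1) (v - x *\<^sub>R axis i 1 - y *\<^sub>R axis j 1) = ?q + c * x - y"
      by (simp add: tits_form_diff_right tits_form_scaleR_right B c_def)
    then show ?thesis unfolding simple_reflection_def scaleR_add_left by simp
  qed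
  have step_i: "simple_reflection I m i (v - x *\<^sub>R axis i 1 - y *\<^sub>R axis j 1)
      = v - (x + 2 * (?p - x + c * y)) *\<^sub>R axis i 1 - y *\<^sub>R axis j 1" for x y
  proof -
    have "tits_form I m (axis i 1) (v - x *\<^sub>R axis i 1 - y *\<^sub>R axis j 1) = ?p - x + c * y"
      by (simp add: tits_form_diff_right tits_form_scaleR_right B c_def)
    then show ?thesis unfolding simple_reflection_def scaleR_add_left by simp
  qed
  have "((simple_reflection I m i \<circ> simple_reflection I m j) ^^ Suc k) v =
     simple_reflection I m i (simple_reflection I m j (v - ?A *\<^sub>R axis i 1 - ?B *\<^sub>R axis j 1))"
    unfolding funpow.simps comp_apply Suc.IH by (simp add: a_def b_def c_def)
  also have "\<dots> = v - (?A + 2 * (?p - ?A + c * (?B + 2 * (?q + c * ?A - ?B)))) *\<^sub>R axis i 1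
     - (?B + 2 * (?q + c * ?A - ?B)) *\<^sub>R axis j 1"
    by (simp only: step_j step_i)
  also have "?B + 2 * (?q + c * ?A - ?B) = b * (2 * ?q * b + 2 * ?p * (2 * c * b - (2 * c * b - a)))"
    using q by algebra
  also have "?A + 2 * (?p - ?A + c * (b * (2 * ?q * b + 2 * ?p * (2 * c * b - (2 * c * b - a)))))
     = b * (2 * ?p * b + 2 * ?q * (2 * c * b - a))"
    using q by algebra
  finally show ?case using rec by (simp add: b_def c_def)
qed

lemma foldr_relator:
  "foldr f (concat (replicate k [i, j])) = (f i \<circ> f j) ^^ k"
  by (induction k) (simp_all add: fun_eq_iff)

lemma simple_reflection_relation:
  assumes "coxeter_matrix I m" "i \<in> I" "j \<in> I"
  shows "(simple_reflection I m i \<circ> simple_reflection I m j) ^^ m i j = id"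
proof (cases "i = j \<or> m i j = 0")
  case True
  then show ?thesis
    using assms simple_reflection_involution[OF assms(1,2)]
    by (auto simp: coxeter_matrix_def fun_eq_iff)
next
  case False
  then show ?thesis
    using dihedral_power[OF assms, of "m i j"] by (simp add: fun_eq_iff)
qed

lemma foldr_coxeter_equiv:
  assumes "coxeter_matrix I m" "coxeter_equiv I m u v"
  shows "foldr (simple_reflection I m) u = foldr (simple_reflection I m) v"
  using assms(2)
  by induction
     (simp_all add: foldr_relator simple_reflection_relation[OF assms(1)])

lemma list_mult_closed:
  "\<lbrakk>group G; set xs \<subseteq> carrier G\<rbrakk> \<Longrightarrow> list_mult G xs \<in> carrier G"
  by (induction xs) (auto simp: list_mult_def group.is_monoid monoid.m_closed)

lemma list_mult_append:
  assumes "group G" "set xs \<subseteq> carrier G" "set ys \<subseteq> carrier G"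
  shows "list_mult G (xs @ ys) = list_mult G xs \<otimes>\<^bsub>G\<^esub> list_mult G ys"
proof -
  interpret group G by fact
  show ?thesis using assms(2)
  proof (induction xs)
    case Nil
    then show ?case using list_mult_closed[OF assms(1,3)] by (simp add: list_mult_def)
  next
    case (Cons x xs)
    then show ?case
      using list_mult_closed[OF assms(1), of xs] list_mult_closed[OF assms(1,3)]
      by (simp add: list_mult_def m_assoc)
  qed
qed

lemma coxeter_generator_square:
  assumes "coxeter_system G I s m" "i \<in> I"
  shows "s i \<otimes>\<^bsub>G\<^esub> s i = \<one>\<^bsub>G\<^esub>"
proof -
  interpret group G using assms by (simp add: coxeter_system_def)
  have "m i i = 1" using assms by (auto simp: coxeter_system_def coxeter_matrix_def)
  then have "coxeter_equiv I m [i, i] []"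
    using coxeter_equiv.relator[of i I i "[]" "[]" m] assms(2) by simp
  moreover have "[i, i] \<in> lists I" using assms(2) by simp
  moreover have "list_mult G (map s u) = list_mult G (map s v) \<longleftrightarrow> coxeter_equiv I m u v"
    if "u \<in> lists I" "v \<in> lists I" for u v
    using assms(1) that unfolding coxeter_system_def by blast
  ultimately have "list_mult G (map s [i, i]) = list_mult G (map s [])" by blast
  moreover have "s i \<in> carrier G" using assms by (auto simp: coxeter_system_def)
  ultimately show ?thesis by (simp add: list_mult_def)
qed

lemma coxeter_word_exists:
  assumes cs: "coxeter_system G I s m" and g: "g \<in> carrier G"
  shows "\<exists>u. u \<in> lists I \<and> list_mult G (map s u) = g"
proof -
  have grp: "group G" using cs by (simp add: coxeter_system_def)
  interpret group G by fact
  have sub: "s ` I \<subseteq> carrier G" using cs by (simp add: coxeter_system_def)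
  have "g \<in> generate G (s ` I)" using cs g by (simp add: coxeter_system_def)
  then show ?thesis
  proof (induction rule: generate.induct)
    case one
    then show ?case by (intro exI[of _ "[]"]) (simp add: list_mult_def)
  next
    case (incl h)
    then obtain i where "i \<in> I" "h = s i" by auto
    then show ?case using sub by (intro exI[of _ "[i]"]) (auto simp: list_mult_def)
  next
    case (inv h)
    then obtain i where i: "i \<in> I" "h = s i" by auto
    then have "h \<otimes>\<^bsub>G\<^esub> h = \<one>\<^bsub>G\<^esub>" "h \<in> carrier G"
      using coxeter_generator_square[OF cs] sub by auto
    then have "inv\<^bsub>G\<^esub> h = h" by (simp add: inv_equality)
    then show ?case using i sub by (intro exI[of _ "[i]"]) (auto simp: list_mult_def)
  next
    case (eng h1 h2)
    then obtain u v where uv: "u \<in> lists I" "list_mult G (map s u) = h1"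
      "v \<in> lists I" "list_mult G (map s v) = h2" by blast
    moreover have "set (map s u) \<subseteq> carrier G" "set (map s v) \<subseteq> carrier G"
      using uv sub by auto
    ultimately show ?case
      using list_mult_append[OF grp] by (intro exI[of _ "u @ v"]) auto
  qed
qed

lemma tits_rep_word:
  assumes cs: "coxeter_system G I s m" and u: "u \<in> lists I"
  shows "tits_rep G I s m (list_mult G (map s u)) = foldr (simple_reflection I m) u"
proof -
  let ?P = "\<lambda>v. v \<in> lists I \<and> list_mult G (map s v) = list_mult G (map s u)"
  define v where "v = (SOME v. ?P v)"
  have "?P v" unfolding v_def by (rule someI[of ?P u]) (use u in blast)
  then have "coxeter_equiv I m v u"
    using cs u unfolding coxeter_system_def by blast
  then have "foldr (simple_reflection I m) v = foldr (simple_reflection I m) u"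
    using cs by (intro foldr_coxeter_equiv) (auto simp: coxeter_system_def)
  then show ?thesis by (simp add: tits_rep_def v_def)
qed

theorem tits_rep_generator:
  assumes "coxeter_system G I s m" "i \<in> I"
  shows "tits_rep G I s m (s i) = simple_reflection I m i"
proof -
  interpret group G using assms by (simp add: coxeter_system_def)
  have "s i \<in> carrier G" using assms by (auto simp: coxeter_system_def)
  then show ?thesis
    using tits_rep_word[OF assms(1), of "[i]"] assms(2) by (simp add: list_mult_def)
qed

theorem tits_rep_mult:
  assumes cs: "coxeter_system G I s m" and "g \<in> carrier G" "h \<in> carrier G"
  shows "tits_rep G I s m (g \<otimes>\<^bsub>G\<^esub> h) = tits_rep G I s m g \<circ> tits_rep G I s m h"
proof -
  obtain u v where uv: "u \<in> lists I" "g = list_mult G (map s u)"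
      "v \<in> lists I" "h = list_mult G (map s v)"
    using coxeter_word_exists[OF cs] assms(2,3) by metis
  have sub: "s ` I \<subseteq> carrier G" and grp: "group G"
    using cs by (simp_all add: coxeter_system_def)
  have "g \<otimes>\<^bsub>G\<^esub> h = list_mult G (map s (u @ v))"
    using uv sub list_mult_append[OF grp, of "map s u" "map s v"] by (simp add: image_subset_iff in_lists_conv_set)
  moreover have "u @ v \<in> lists I" using uv by simp
  ultimately have "tits_rep G I s m (g \<otimes>\<^bsub>G\<^esub> h) = foldr (simple_reflection I m) (u @ v)"
    using tits_rep_word[OF cs, of "u @ v"] by simp
  then show ?thesis
    using tits_rep_word[OF cs] uv by (simp add: fun_eq_iff)
qed

theorem tits_rep_linear:
  assumes "coxeter_system G I s m" "g \<in> carrier G"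
  shows "linear (tits_rep G I s m g)"
proof -
  obtain u where u: "u \<in> lists I" "g = list_mult G (map s u)"
    using coxeter_word_exists[OF assms] by metis
  have "linear (foldr (simple_reflection I m) w)" for w
  proof (induction w)
    case Nil
    then show ?case using linear_id by (simp add: id_def)
  next
    case (Cons i w)
    then show ?case
      using linear_compose[OF Cons.IH linear_simple_reflection[of I m i]] by (simp add: comp_def)
  qed
  with u assms(1) show ?thesis by (simp add: tits_rep_word)
qed

theorem tits_rep_space:
  assumes "coxeter_system G I s m" "g \<in> carrier G" "v \<in> tits_space I"
  shows "tits_rep G I s m g v \<in> tits_space I"
proof -
  obtain u where u: "u \<in> lists I" "g = list_mult G (map s u)"
    using coxeter_word_exists[OF assms(1,2)] by metis
  have "foldr (simple_reflection I m) u v \<in> tits_space I"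
    using u(1) assms(3) by (induction u) (auto simp: simple_reflection_tits_space)
  with u assms(1) show ?thesis by (simp add: tits_rep_word)
qed

end

theory Submission
  imports Defs
begin

text \<open>
  Two facts carry the proof. The first is Carter's lemma (\<open>reflection_length_eq_codim\<close>):
  \<open>\<ell>\<^sub>T(g)\<close> is the codimension of \<open>Fix(g)\<close>. It turns the absolute order into
  linear algebra: \<open>x \<preceq> y\<close> says that codimensions add up in \<open>y = x (x\<^sup>-\<^sup>1 y)\<close>. The second
  (\<open>absolute_le_iff_fixed_subset\<close>) is that two elements \<open>x, y\<close> below a common \<open>w\<close>
  satisfy \<open>x \<preceq> y\<close> if and only if \<open>Fix(y) \<subseteq> Fix(x)\<close>. The anti-isomorphism, including
  injectivity of \<open>Fix\<close>, is then formal.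

  Carter's lemma. Since \<open>W\<close> is finite, averaging the standard inner product over \<open>W\<close> gives an
  invariant one, and every element of \<open>T\<close> is an orthogonal reflection for it. A product of \<open>k\<close>
  reflections fixes an intersection of \<open>k\<close> hyperplanes, so the codimension is at most
  \<open>\<ell>\<^sub>T(g)\<close>. Conversely, for \<open>g \<noteq> 1\<close> one needs a reflection \<open>t\<close> such that \<open>t g\<close> fixes a strictly
  larger space. Any \<open>t\<close> that fixes \<open>Fix(g)\<close> pointwise will do: its root lies in the image of
  \<open>g - 1\<close>, that is, it has the form \<open>g v - v\<close>, and as \<open>v\<close> and \<open>g v\<close> have equal norm,
  \<open>t\<close> maps \<open>g v\<close> back to \<open>v\<close>.

  Such a \<open>t\<close> exists because only the identity fixes a point that lies on no mirror. This is where
  the presentation of \<open>W\<close> enters, through Tits' theorem (\<open>simple_root_image_nonneg\<close>): if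
  \<open>\<ell>(g s\<^sub>i) \<ge> \<ell>(g)\<close> for the word length \<open>\<ell>\<close>, then \<open>g e\<^sub>i\<close> has nonnegative coordinates. So every \<open>g \<noteq> 1\<close> makes
  some simple root negative and cannot fix a point of the open fundamental chamber. Hence
  \<open>Fix(g)\<close> is covered by finitely many mirrors, and therefore by one of them.

  The order below \<open>w\<close>. If \<open>w = x a = y b\<close> with additive codimensions, then
  \<open>Fix(w) = Fix(x) \<inter> Fix(a)\<close>, and \<open>w - 1\<close> maps \<open>Fix(a)\<close> onto the image of \<open>x - 1\<close>, which is
  the orthogonal complement of \<open>Fix(x)\<close>; likewise for \<open>y\<close> and \<open>b\<close>. From
  \<open>Fix(y) \<subseteq> Fix(x)\<close> it follows that \<open>Fix(a) \<subseteq> Fix(b)\<close>, so \<open>x\<close> and \<open>y\<close> both agree with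
  \<open>w\<close> on \<open>Fix(a)\<close>. They also agree on \<open>Fix(y)\<close>, and these two spaces together are
  large enough to force \<open>\<ell>\<^sub>T(x\<^sup>-\<^sup>1 y) \<le> \<ell>\<^sub>T(y) - \<ell>\<^sub>T(x)\<close>.

  All dimension counts take place in the full coordinate space \<open>real ^ 'n\<close>, on which \<open>W\<close> acts by
  fixing the coordinate directions outside \<open>I\<close>; codimensions and inclusions of fixed spaces are the
  same as in the space of the Tits representation.
\<close>

section \<open>Subspaces of a finite-dimensional space\<close>

text \<open>Induction on the number of subspaces. If \<open>v \<in> S\<close> avoids all subspaces but the new one, move
  along the line through some \<open>u \<in> S\<close> outside the new one in direction \<open>v\<close>: that line never
  enters the new subspace and meets each of the old ones at most once.\<close>

lemma subspace_avoids_finite_union: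
  fixes S :: "'v::real_vector set"
  assumes "finite F" "subspace S" "\<And>A. A \<in> F \<Longrightarrow> subspace A" "\<And>A. A \<in> F \<Longrightarrow> \<not> S \<subseteq> A"
  shows "\<exists>v\<in>S. \<forall>A\<in>F. v \<notin> A"
  using assms
proof (induction F rule: finite_induct)
  case empty
  then show ?case using subspace_0 by blast
next
  case (insert A F)
  then obtain v where v: "v \<in> S" "\<forall>B\<in>F. v \<notin> B" by auto
  obtain u where u: "u \<in> S" "u \<notin> A" using insert.prems(3)[of A] by auto
  show ?case
  proof (cases "v \<in> A")
    case True
    define bad where "bad B = {c::real. u + c *\<^sub>R v \<in> B}" for B
    have "finite (bad B)" if B: "B \<in> F" for B
    proof (cases "bad B = {}")
      case False
      then obtain c where c: "c \<in> bad B" by auto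
      have "d = c" if "d \<in> bad B" for d
      proof (rule ccontr)
        assume ne: "d \<noteq> c"
        have "(u + d *\<^sub>R v) - (u + c *\<^sub>R v) \<in> B"
          using insert.prems(2)[of B] B c that by (intro subspace_diff) (auto simp: bad_def)
        then have "(d - c) *\<^sub>R v \<in> B" by (simp add: scaleR_diff_left)
        then have "inverse (d - c) *\<^sub>R (d - c) *\<^sub>R v \<in> B"
          using insert.prems(2)[of B] B by (blast intro: subspace_scale)
        with ne v(2) B show False by simp
      qed
      then have "bad B \<subseteq> {c}" by auto
      then show ?thesis by (rule finite_subset) simp
    qed simp
    then have "finite (\<Union>B\<in>F. bad B)" using insert.hyps(1) by blast
    then obtain c where c: "c \<notin> (\<Union>B\<in>F. bad B)"
      using ex_new_if_finite[OF infinite_UNIV_char_0] by blast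
    have "u + c *\<^sub>R v \<in> S"
      using u v insert.prems(1) by (intro subspace_add subspace_scale)
    moreover have "u + c *\<^sub>R v \<notin> A"
    proof
      assume "u + c *\<^sub>R v \<in> A"
      then have "(u + c *\<^sub>R v) - c *\<^sub>R v \<in> A"
        using insert.prems(2)[of A] True by (intro subspace_diff subspace_scale) auto
      with u(2) show False by simp
    qed
    ultimately show ?thesis using c by (intro bexI[of _ "u + c *\<^sub>R v"]) (auto simp: bad_def)
  qed (use v in auto)
qed

lemma subspace_eq_UNIV:
  fixes S :: "(real ^ 'k::finite) set"
  shows "\<lbrakk>subspace S; dim S = CARD('k)\<rbrakk> \<Longrightarrow> S = UNIV"
  by (rule subspace_dim_equal) auto

text \<open>The map is injective on the orthogonal complement of its kernel, and that complement has the
  same image as the whole space.\<close>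

lemma dim_range_add_dim_kernel:
  fixes f :: "'v::euclidean_space \<Rightarrow> 'v"
  assumes f: "linear f"
  shows "dim (range f) + dim {v. f v = 0} = DIM('v)"
proof -
  let ?K = "{v. f v = 0}"
  define U where "U = {y \<in> UNIV. \<forall>x\<in>?K. orthogonal x y}"
  have K: "subspace ?K" using linear_subspace_kernel[OF f] .
  have U: "subspace U"
    unfolding U_def subspace_def by (auto simp: orthogonal_clauses)
  have dimU: "dim U + dim ?K = DIM('v)"
    using dim_subspace_orthogonal_to_vectors[OF K subspace_UNIV] by (simp add: U_def)
  have inj: "inj_on f U"
  proof (rule inj_onI)
    fix x y assume xy: "x \<in> U" "y \<in> U" "f x = f y"
    then have "x - y \<in> U" "x - y \<in> ?K"
      using U f by (auto simp: subspace_diff linear_diff)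
    then have "orthogonal (x - y) (x - y)" unfolding U_def by blast
    then show "x = y" by (simp add: orthogonal_self)
  qed
  have "range f \<subseteq> f ` U"
  proof clarify
    fix x
    obtain y z where yz: "y \<in> span ?K" "\<And>w. w \<in> span ?K \<Longrightarrow> orthogonal z w" "x = y + z"
      using orthogonal_subspace_decomp_exists[of ?K x] by blast
    moreover have "span ?K = ?K" using K by (simp only: span_eq_iff)
    ultimately have "y \<in> ?K" "z \<in> U"
      by (simp_all add: U_def orthogonal_commute)
    then show "f x \<in> f ` U" using yz(3) f by (auto simp: linear_add)
  qed
  then have "range f = f ` U" by auto
  moreover have "dim (f ` U) = dim U"
    using U inj by (intro dim_image_eq f) (simp only: span_eq_iff[THEN iffD2])
  ultimately show ?thesis using dimU by simp
qed


section \<open>Words and length in a Coxeter system\<close>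

locale coxeter =
  fixes W :: "('a, 'b) monoid_scheme" (structure)
    and I :: "'n::finite set" and s :: "'n \<Rightarrow> 'a" and m :: "'n \<Rightarrow> 'n \<Rightarrow> nat"
  assumes coxeter_system: "coxeter_system W I s m"
begin

sublocale group W
  using coxeter_system by (simp add: coxeter_system_def)

abbreviation act :: "'a \<Rightarrow> real ^ 'n \<Rightarrow> real ^ 'n" where
  "act \<equiv> tits_rep W I s m"

abbreviation form :: "real ^ 'n \<Rightarrow> real ^ 'n \<Rightarrow> real" where
  "form \<equiv> tits_form I m"

abbreviation simple_root :: "'n \<Rightarrow> real ^ 'n" where
  "simple_root i \<equiv> axis i 1"

definition word :: "'n list \<Rightarrow> 'a" where
  "word u = list_mult W (map s u)"

definition len :: "'a \<Rightarrow> nat" where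
  "len g = (LEAST k. \<exists>u\<in>lists I. length u = k \<and> word u = g)"

lemma cox_matrix: "coxeter_matrix I m"
  using coxeter_system by (simp add: coxeter_system_def)

lemma s_closed [simp]: "i \<in> I \<Longrightarrow> s i \<in> carrier W"
  using coxeter_system by (auto simp: coxeter_system_def)

lemma s_square [simp]: "i \<in> I \<Longrightarrow> s i \<otimes> s i = \<one>"
  using coxeter_generator_square[OF coxeter_system] .

lemma cancel_left [simp]:
  assumes "g \<in> carrier W" "h \<in> carrier W"
  shows "inv h \<otimes> (h \<otimes> g) = g" "h \<otimes> (inv h \<otimes> g) = g"
  using assms by (simp_all add: m_assoc[symmetric])

lemma s_cancel_left [simp]: "\<lbrakk>i \<in> I; g \<in> carrier W\<rbrakk> \<Longrightarrow> s i \<otimes> (s i \<otimes> g) = g"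
  by (simp add: m_assoc[symmetric])

lemma word_closed [simp]: "u \<in> lists I \<Longrightarrow> word u \<in> carrier W"
  unfolding word_def by (rule list_mult_closed[OF is_group]) (auto simp: in_lists_conv_set)

lemma word_Nil [simp]: "word [] = \<one>"
  by (simp add: word_def list_mult_def)

lemma word_Cons [simp]: "word (i # u) = s i \<otimes> word u"
  by (simp add: word_def list_mult_def)

lemma word_append:
  "\<lbrakk>u \<in> lists I; v \<in> lists I\<rbrakk> \<Longrightarrow> word (u @ v) = word u \<otimes> word v"
  by (induction u) (auto simp: m_assoc)

lemma word_snoc_cancel:
  assumes "u \<in> lists I" "i \<in> I"
  shows "word (u @ [i]) \<otimes> s i = word u"
  using assms by (simp add: word_append m_assoc)

lemma word_rev: "u \<in> lists I \<Longrightarrow> word (rev u) \<otimes> word u = \<one>"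
proof (induction u)
  case (Cons i u)
  then have "word (rev (i # u)) \<otimes> word (i # u) = word (rev u) \<otimes> (s i \<otimes> s i) \<otimes> word u"
    by (simp add: word_append m_assoc lists_eq_set del: s_square)
  with Cons show ?case by (simp add: lists_eq_set)
qed simp

lemma len_word_le: "u \<in> lists I \<Longrightarrow> len (word u) \<le> length u"
  unfolding len_def by (rule Least_le) auto

lemma reduced_word_exists:
  assumes "g \<in> carrier W"
  obtains u where "u \<in> lists I" "word u = g" "length u = len g"
proof -
  have "\<exists>k. \<exists>u\<in>lists I. length u = k \<and> word u = g"
    using coxeter_word_exists[OF coxeter_system assms] by (auto simp: word_def)
  from LeastI_ex[OF this] show thesis
    using that unfolding len_def by blast
qed

lemma act_word: "u \<in> lists I \<Longrightarrow> act (word u) = foldr (simple_reflection I m) u"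
  unfolding word_def by (rule tits_rep_word[OF coxeter_system])

lemma act_one [simp]: "act \<one> v = v"
  using act_word[of "[]"] by simp

lemma act_mult [simp]:
  "\<lbrakk>g \<in> carrier W; h \<in> carrier W\<rbrakk> \<Longrightarrow> act (g \<otimes> h) v = act g (act h v)"
  using tits_rep_mult[OF coxeter_system] by simp

lemma act_linear: "g \<in> carrier W \<Longrightarrow> linear (act g)"
  by (rule tits_rep_linear[OF coxeter_system])

lemma act_s: "i \<in> I \<Longrightarrow> act (s i) v = v - (2 * form (simple_root i) v) *\<^sub>R simple_root i"
  using tits_rep_generator[OF coxeter_system] by (simp add: simple_reflection_def)

lemma act_inv_act [simp]: "g \<in> carrier W \<Longrightarrow> act (inv g) (act g v) = v"
  using act_mult[of "inv g" g v] by simp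

lemma act_act_inv [simp]: "g \<in> carrier W \<Longrightarrow> act g (act (inv g) v) = v"
  using act_mult[of g "inv g" v] by simp

lemma form_simple_root_self: "i \<in> I \<Longrightarrow> form (simple_root i) (simple_root i) = 1"
  using cox_matrix by (auto simp: tits_form_axis_axis coxeter_matrix_def)


section \<open>Positivity of roots\<close>

text \<open>The alternating word of length \<open>k\<close> in \<open>i\<close> and \<open>j\<close> whose last letter is \<open>j\<close>. It is
  built from the right, so that \<open>foldr\<close> applies the letters in the order of the recursion.\<close>

primrec alternating :: "'n \<Rightarrow> 'n \<Rightarrow> nat \<Rightarrow> 'n list" where
  "alternating j i 0 = []"
| "alternating j i (Suc k) = (if even k then j else i) # alternating j i k"

lemma length_alternating [simp]: "length (alternating j i k) = k"
  by (induction k) auto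

lemma alternating_in_lists [simp]: "\<lbrakk>i \<in> J; j \<in> J\<rbrakk> \<Longrightarrow> alternating j i k \<in> lists J"
  by (induction k) auto

lemma alternating_snoc: "alternating j i (Suc k) = alternating i j k @ [j]"
  by (induction k) auto

lemma alternating_double: "alternating j i (2 * k) = concat (replicate k [i, j])"
  by (induction k) auto

lemma alternating_add:
  "alternating j i (k + l) = (if even l then alternating j i k else alternating i j k) @ alternating j i l"
  by (induction k) auto

lemma rev_alternating:
  "rev (alternating i j k) = (if even k then alternating j i k else alternating i j k)"
proof (induction k arbitrary: i j)
  case (Suc k)
  have "rev (alternating i j (Suc k)) = i # rev (alternating j i k)"
    by (simp only: alternating_snoc rev_append) simp
  with Suc.IH[of j i] show ?case by simp
qed simp

text \<open>The defining relator \<open>(i j)\<^bsup>m(i,j)\<^esup>\<close> splits into two halves: the first is the reverse,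
  hence the inverse, of the alternating word that ends in \<open>i\<close>, the second is the alternating
  word that ends in \<open>j\<close>.\<close>

lemma braid_relation:
  assumes "i \<in> I" "j \<in> I"
  shows "word (alternating i j (m i j)) = word (alternating j i (m i j))"
proof -
  let ?a = "alternating i j (m i j)" and ?b = "alternating j i (m i j)"
  have l: "?a \<in> lists I" "?b \<in> lists I" using assms by simp_all
  have "coxeter_equiv I m (concat (replicate (m i j) [i, j])) []"
    using coxeter_equiv.relator[of i I j "[]" "[]" m] assms by simp
  then have "word (concat (replicate (m i j) [i, j])) = word []"
    using coxeter_system assms unfolding coxeter_system_def word_def
    by (metis lists.Nil alternating_double alternating_in_lists)
  moreover have "concat (replicate (m i j) [i, j]) = rev ?a @ ?b"
    unfolding alternating_double[symmetric] mult_2 by (simp add: alternating_add rev_alternating)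
  ultimately have "word (rev ?a) \<otimes> word ?b = \<one>"
    using l by (simp add: word_append lists_eq_set)
  moreover have "word (rev ?a) \<otimes> word ?a = \<one>"
    using l by (simp add: word_rev)
  ultimately show ?thesis
    using l Units_l_cancel[of "word (rev ?a)" "word ?a" "word ?b"] by (simp add: lists_eq_set)
qed

text \<open>The Chebyshev values that describe the roots of the dihedral group of order \<open>2 n\<close>, with the
  limit as the angle tends to \<open>0\<close> for \<open>n = 0\<close>, which encodes the infinite dihedral group.\<close>

definition dihedral_coeff :: "nat \<Rightarrow> nat \<Rightarrow> real" where
  "dihedral_coeff n k = (if n = 0 then real k else sin (real k * (pi / n)) / sin (pi / n))"

lemma dihedral_coeff_rec:
  assumes "n \<noteq> 1"
  shows "dihedral_coeff n (k + 2) = 2 * cos (pi / n) * dihedral_coeff n (k + 1) - dihedral_coeff n k"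
proof (cases "n = 0")
  case False
  define t where "t = pi / n"
  have "0 < t" "t < pi" using False assms by (auto simp: t_def divide_less_eq)
  then have st: "sin t > 0" by (rule sin_gt_zero)
  have "sin (real (k + 2) * t) + sin (real k * t) = 2 * cos t * sin (real (k + 1) * t)"
    using sin_add[of "real (k+1) * t" t] sin_diff[of "real (k+1) * t" t]
    by (simp add: algebra_simps)
  then show ?thesis
    using st False by (simp add: dihedral_coeff_def t_def[symmetric] field_simps)
qed (simp add: dihedral_coeff_def)

lemma dihedral_coeff_0_1: "n \<noteq> 1 \<Longrightarrow> dihedral_coeff n 0 = 0 \<and> dihedral_coeff n 1 = 1"
proof -
  assume n: "n \<noteq> 1"
  have "sin (pi / n) \<noteq> 0" if "n \<noteq> 0"
    using n that sin_gt_zero[of "pi / n"] by (auto simp: divide_less_eq)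
  then show ?thesis by (simp add: dihedral_coeff_def)
qed

lemma dihedral_coeff_nonneg:
  assumes "n = 0 \<or> k \<le> n"
  shows "dihedral_coeff n k \<ge> 0"
proof (cases "n = 0")
  case False
  have "real k * (pi / n) \<le> pi" "pi / n \<le> pi"
    using assms False by (auto simp: field_simps)
  then show ?thesis
    using False by (auto simp: dihedral_coeff_def intro!: divide_nonneg_nonneg sin_ge_zero)
qed (simp add: dihedral_coeff_def)

text \<open>Each further letter reflects in the simple root that carries the smaller index, and the
  Chebyshev recurrence shifts both coefficients by one.\<close>

lemma act_alternating:
  assumes ij: "i \<in> I" "j \<in> I" "i \<noteq> j"
  shows "act (word (alternating j i k)) (simple_root i) =
    dihedral_coeff (m i j) (k + 1) *\<^sub>R simple_root (if even k then i else j)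
    + dihedral_coeff (m i j) k *\<^sub>R simple_root (if even k then j else i)"
proof (induction k)
  have m1: "m i j \<noteq> 1" "m j i = m i j"
    using cox_matrix ij by (auto simp: coxeter_matrix_def)
  {
    case 0
    show ?case using dihedral_coeff_0_1[OF m1(1)] by simp
  next
    case (Suc k)
    define p q where "p = dihedral_coeff (m i j) (k + 1)" and "q = dihedral_coeff (m i j) k"
    define x y where "x = (if even k then i else j)" and "y = (if even k then j else i)"
    have xy: "x \<in> I" "y \<in> I" using ij by (auto simp: x_def y_def)
    have B: "form (simple_root y) (simple_root y) = 1"
        "form (simple_root y) (simple_root x) = - cos (pi / m i j)"
      using xy m1 form_simple_root_self by (auto simp: x_def y_def tits_form_axis_axis)
    have "act (word (alternating j i (Suc k))) (simple_root i)
        = act (s y) (act (word (alternating j i k)) (simple_root i))"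
      using ij xy by (simp add: y_def)
    also have "\<dots> = p *\<^sub>R simple_root x + q *\<^sub>R simple_root y
        - (2 * (q - cos (pi / m i j) * p)) *\<^sub>R simple_root y"
      unfolding Suc.IH x_def[symmetric] y_def[symmetric] p_def[symmetric] q_def[symmetric]
      using xy by (simp add: act_s tits_form_add_right tits_form_scaleR_right B mult.commute)
    also have "\<dots> = p *\<^sub>R simple_root x
        + (q - 2 * (q - cos (pi / m i j) * p)) *\<^sub>R simple_root y"
      by (simp only: scaleR_diff_left) simp
    also have "q - 2 * (q - cos (pi / m i j) * p) = dihedral_coeff (m i j) (k + 2)"
      using dihedral_coeff_rec[OF m1(1), of k] by (simp add: p_def q_def)
    finally show ?case by (auto simp: x_def y_def p_def)
  }
qed

text \<open>Tits' theorem, by induction on the length. Let \<open>j\<close> be the last letter of a reduced word of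
  \<open>g\<close>. Among all reduced factorizations of \<open>g\<close> as a word \<open>a\<close> followed by a word \<open>b\<close> in
  \<open>i\<close> and \<open>j\<close>, take one with \<open>a\<close> as short as possible. Then neither \<open>i\<close> nor \<open>j\<close>
  shortens \<open>a\<close>, so by induction \<open>a\<close> maps both simple roots to nonnegative vectors. The word
  \<open>b\<close> is alternating, ends in \<open>j\<close> and has fewer than \<open>m i j\<close> letters if \<open>m i j\<close> is
  finite; so it maps the simple root of \<open>i\<close> to a nonnegative combination of the two.\<close>

lemma simple_root_image_nonneg:
  assumes "g \<in> carrier W" "i \<in> I" "len g \<le> len (g \<otimes> s i)"
  shows "0 \<le> act g (simple_root i) $ k"
  using assms
proof (induction "len g" arbitrary: g i k rule: less_induct)
  case less
  note i = \<open>i \<in> I\<close>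
  obtain u where u: "u \<in> lists I" "word u = g" "length u = len g"
    using less.prems(1) by (rule reduced_word_exists)
  show ?case
  proof (cases u rule: rev_cases)
    case Nil
    then have "g = \<one>" using u by simp
    then show ?thesis by (simp add: axis_def)
  next
    case (snoc u' j)
    have u': "u' \<in> lists I" and j: "j \<in> I" using u snoc by auto
    have shorter: False
      if "v \<in> lists I" "word v = g \<otimes> s i" "length v < len g" for v
      using len_word_le[OF that(1)] that less.prems(3) by simp
    have reduced: "len g \<le> length v" if "v \<in> lists I" "word v = g" for v
      using len_word_le[OF that(1)] that(2) by simp
    have "i \<noteq> j"
    proof
      assume "i = j"
      then have "word u' = g \<otimes> s i" using word_snoc_cancel[OF u' j] u(2) snoc by simp
      then show False using shorter[of u'] u' u(3) snoc by simp
    qed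
    define P where "P n \<longleftrightarrow> (\<exists>a b. a \<in> lists I \<and> b \<in> lists {i, j} \<and> word (a @ b) = g
        \<and> length (a @ b) = len g \<and> length a = n)" for n
    have P0: "P (length u')"
      unfolding P_def using u u' snoc by (intro exI[of _ u'] exI[of _ "[j]"]) auto
    obtain a b where ab: "a \<in> lists I" "b \<in> lists {i, j}" "word (a @ b) = g"
        "length (a @ b) = len g" and least: "\<And>n. P n \<Longrightarrow> length a \<le> n"
      using LeastI[of P, OF P0] Least_le[of P] unfolding P_def[of "Least P"] by metis
    have bI: "b \<in> lists I" using ab(2) i j by auto
    have short_a: "length a < len g" using least[OF P0] u(3) snoc by simp
    \<comment> \<open>If \<open>x\<close> shortened \<open>a\<close>, it could be moved over to \<open>b\<close>, against minimality of \<open>a\<close>.\<close>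
    have up: "len (word a) \<le> len (word a \<otimes> s x)" if x: "x \<in> {i, j}" for x
    proof (rule ccontr)
      assume neg: "\<not> ?thesis"
      have xI: "x \<in> I" using x i j by auto
      obtain a' where a': "a' \<in> lists I" "word a' = word a \<otimes> s x"
          "length a' = len (word a \<otimes> s x)"
        by (rule reduced_word_exists[of "word a \<otimes> s x"]) (use ab xI in auto)
      have l: "length a' < length a" using neg a'(3) len_word_le[OF ab(1)] by simp
      have "word (a' @ x # b) = word a \<otimes> (s x \<otimes> s x) \<otimes> word b"
        using a' ab bI xI by (simp add: word_append m_assoc del: s_square)
      then have eq: "word (a' @ x # b) = g"
        using ab bI xI by (simp add: word_append)
      then have "length (a' @ x # b) = len g"
        using reduced[of "a' @ x # b"] a' bI xI l ab(4) by simp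
      then have "P (length a')"
        unfolding P_def using a' ab x eq by (intro exI[of _ a'] exI[of _ "x # b"]) auto
      then show False using least l by fastforce
    qed
    have pos: "0 \<le> act (word a) (simple_root x) $ k" if x: "x \<in> {i, j}" for x k
      using less.hyps[of "word a" x k] up[OF x] len_word_le[OF ab(1)] short_a ab(1) x i j by auto
    \<comment> \<open>No letter is repeated in a row, and the last letter is not \<open>i\<close>; so \<open>b\<close> alternates.\<close>
    have suffix: "\<exists>c. b = c @ alternating j i l" if "l \<le> length b" for l
      using that
    proof (induction l)
      case 0
      show ?case by simp
    next
      case (Suc l)
      then obtain c where c: "b = c @ alternating j i l" by auto
      then have "c \<noteq> []" using Suc.prems by auto
      then obtain d x where d: "c = d @ [x]" by (cases c rule: rev_cases) auto
      have x: "x \<in> {i, j}" and dI: "d \<in> lists I" and xI: "x \<in> I"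
        using ab(2) bI c d by auto
      have "x = (if even l then j else i)"
      proof (cases l)
        case 0
        have "x \<noteq> i"
        proof
          assume "x = i"
          then have "word (a @ d) = g \<otimes> s i"
            using word_snoc_cancel[of "a @ d" i] ab(1,3) dI i c d 0 by simp
          then show False using shorter[of "a @ d"] ab(1,4) dI c d by simp
        qed
        with x 0 show ?thesis by simp
      next
        case (Suc l')
        define y where "y = (if even l' then j else i)"
        have "x \<noteq> y"
        proof
          assume "x = y"
          then have b: "b = d @ x # x # alternating j i l'"
            using c d Suc by (simp add: y_def)
          have aI: "alternating j i l' \<in> lists I" using i j by simp
          have "word (x # x # alternating j i l') = word (alternating j i l')"
            using xI aI by (simp add: m_assoc[symmetric])
          then have "word (a @ d @ alternating j i l') = g"
            using ab(1,3) dI xI aI unfolding b by (simp add: word_append)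
          then show False
            using reduced[of "a @ d @ alternating j i l'"] ab(1,4) dI aI b by simp
        qed
        with x Suc \<open>i \<noteq> j\<close> show ?thesis by (auto simp: y_def split: if_splits)
      qed
      then show ?case using c d by auto
    qed
    \<comment> \<open>Otherwise the braid relation yields a reduced word of \<open>g\<close> that ends in \<open>i\<close>.\<close>
    have bound: "m i j = 0 \<or> length b < m i j"
    proof (rule ccontr)
      assume "\<not> ?thesis"
      then obtain n where n: "m i j = Suc n" "m i j \<le> length b" by (cases "m i j") auto
      then obtain c where c: "b = c @ alternating j i (m i j)" using suffix by blast
      have cI: "c \<in> lists I" using bI c by auto
      have "g = word (a @ c) \<otimes> word (alternating j i (m i j))"
        using ab(1,3) cI i j c word_append[of "a @ c" "alternating j i (m i j)"] by simp
      also have "\<dots> = word ((a @ c @ alternating j i n) @ [i])"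
        using ab(1) cI i j braid_relation[OF i j]
        by (simp add: n(1) alternating_snoc word_append m_assoc del: alternating.simps)
      finally have "word (a @ c @ alternating j i n) = g \<otimes> s i"
        using word_snoc_cancel[of "a @ c @ alternating j i n" i] ab(1) cI i j by simp
      then show False
        using shorter[of "a @ c @ alternating j i n"] ab(1,4) cI i j c n by simp
    qed
    obtain b' where "b = b' @ alternating j i (length b)" using suffix[of "length b"] by auto
    then have b: "b = alternating j i (length b)"
      by (metis append_Nil append_eq_append_conv length_alternating)
    define l where "l = length b"
    define p q x y where pq: "p = dihedral_coeff (m i j) (l + 1)" "q = dihedral_coeff (m i j) l"
      "x = (if even l then i else j)" "y = (if even l then j else i)"
    have nn: "p \<ge> 0" "q \<ge> 0" "x \<in> {i, j}" "y \<in> {i, j}"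
      using bound by (auto simp: pq l_def intro!: dihedral_coeff_nonneg)
    have "act g (simple_root i) = act (word a) (act (word b) (simple_root i))"
      using ab bI by (simp add: word_append flip: ab(3))
    also have "act (word b) (simple_root i) = p *\<^sub>R simple_root x + q *\<^sub>R simple_root y"
      using act_alternating[OF i j \<open>i \<noteq> j\<close>, of l] b by (simp add: l_def pq)
    finally have "act g (simple_root i)
        = p *\<^sub>R act (word a) (simple_root x) + q *\<^sub>R act (word a) (simple_root y)"
      using act_linear[OF word_closed[OF ab(1)]] by (simp add: linear_add linear_scale)
    then show ?thesis using nn pos by simp
  qed
qed

text \<open>The last letter \<open>i\<close> of a reduced word does not shorten the rest of the word, which
  therefore keeps the simple root of \<open>i\<close> nonnegative, while \<open>s i\<close> changes its sign.\<close>

lemma negative_simple_root_image: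
  assumes g: "g \<in> carrier W" "g \<noteq> \<one>"
  obtains i where "i \<in> I" "\<And>k. act g (simple_root i) $ k \<le> 0"
proof -
  obtain u where u: "u \<in> lists I" "word u = g" "length u = len g"
    using g(1) by (rule reduced_word_exists)
  then obtain v i where v: "u = v @ [i]" using g(2) by (cases u rule: rev_cases) auto
  then have vi: "v \<in> lists I" "i \<in> I" using u by auto
  have "len (word v) \<le> len (word v \<otimes> s i)"
    using len_word_le[OF vi(1)] u v vi by (simp add: word_append)
  then have nn: "0 \<le> act (word v) (simple_root i) $ k" for k
    using simple_root_image_nonneg[of "word v" i k] vi by simp
  have "act g (simple_root i) = act (word v) (act (s i) (simple_root i))"
    using u v vi by (simp add: word_append flip: u(2))
  also have "act (s i) (simple_root i) = - simple_root i"
    using vi by (simp add: act_s form_simple_root_self scaleR_2)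
  finally have "act g (simple_root i) = - act (word v) (simple_root i)"
    using act_linear[OF word_closed[OF vi(1)]] by (simp add: linear_neg)
  with nn have "act g (simple_root i) $ k \<le> 0" for k by simp
  with vi(2) show thesis by (rule that)
qed

end

section \<open>The invariant inner product\<close>

locale finite_coxeter = coxeter W I s m
  for W :: "('a, 'b) monoid_scheme" (structure)
    and I :: "'n::finite set" and s :: "'n \<Rightarrow> 'a" and m :: "'n \<Rightarrow> 'n \<Rightarrow> nat" +
  assumes finite_carrier: "finite (carrier W)"
begin

text \<open>The standard inner product averaged over \<open>W\<close>, up to a scalar. Averaging makes
  positive definiteness immediate, which it is not for the Tits form.\<close>

definition ip :: "real ^ 'n \<Rightarrow> real ^ 'n \<Rightarrow> real" where
  "ip u v = (\<Sum>g\<in>carrier W. act g u \<bullet> act g v)"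

lemma ip_commute: "ip u v = ip v u"
  by (simp add: ip_def inner_commute)

lemma linear_ip: "linear (ip u)"
  unfolding ip_def
  by (intro linear_compose_sum linearI ballI)
     (simp_all add: inner_add_right linear_add[OF act_linear] linear_scale[OF act_linear])

lemma ip_simps [simp]:
  "ip u (v + w) = ip u v + ip u w" "ip (v + w) u = ip v u + ip w u"
  "ip u (v - w) = ip u v - ip u w" "ip (v - w) u = ip v u - ip w u"
  "ip u (- v) = - ip u v" "ip u (c *\<^sub>R v) = c * ip u v" "ip (c *\<^sub>R v) u = c * ip v u"
  using linear_ip[of u]
  by (simp_all add: ip_commute[of _ u] linear_add linear_diff linear_neg linear_scale)

lemma ip_sum_right: "ip u (\<Sum>j\<in>J. f j) = (\<Sum>j\<in>J. ip u (f j))"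
  by (rule linear_sum[OF linear_ip])

lemma ip_pos: "v \<noteq> 0 \<Longrightarrow> ip v v > 0"
  unfolding ip_def by (rule sum_pos2[of _ \<one>]) (simp_all add: finite_carrier)

lemma ip_eq_0_iff [simp]: "ip v v = 0 \<longleftrightarrow> v = 0"
  using ip_pos[of v] linear_0[OF linear_ip] by fastforce

lemma ip_act:
  assumes h: "h \<in> carrier W"
  shows "ip (act h u) (act h v) = ip u v"
  unfolding ip_def
  by (rule sum.reindex_bij_witness[of _ "\<lambda>g. g \<otimes> inv h" "\<lambda>g. g \<otimes> h"])
     (use h in \<open>simp_all add: m_assoc\<close>)

text \<open>The generator \<open>s i\<close> is an isometry that negates its root, so it is the orthogonal
  reflection in that root; comparing with the formula for \<open>s i\<close> shows that the inner
  product with \<open>simple_root i\<close> is a positive multiple of the Tits form with it.\<close>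

lemma ip_simple_root:
  assumes "i \<in> I"
  shows "ip (simple_root i) v = ip (simple_root i) (simple_root i) * form (simple_root i) v"
proof -
  have "ip (simple_root i) v = ip (act (s i) (simple_root i)) (act (s i) v)"
    using assms by (simp add: ip_act)
  also have "act (s i) (simple_root i) = (- 1) *\<^sub>R simple_root i"
    using assms by (simp add: act_s form_simple_root_self scaleR_2)
  also have "ip ((- 1) *\<^sub>R simple_root i) (act (s i) v)
      = 2 * (ip (simple_root i) (simple_root i) * form (simple_root i) v) - ip (simple_root i) v"
    using assms by (simp only: act_s ip_simps) simp
  finally show ?thesis by linarith
qed

lemma simple_root_form_pos_iff:
  assumes "i \<in> I"
  shows "ip (simple_root i) v > 0 \<longleftrightarrow> form (simple_root i) v > 0"
  using ip_simple_root[OF assms, of v] ip_pos[of "simple_root i"]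
  by (simp add: zero_less_mult_iff axis_eq_0_iff)


section \<open>Reflections and fixed spaces\<close>

abbreviation refls :: "'a set" where
  "refls \<equiv> reflections W (s ` I)"

definition fixed :: "'a \<Rightarrow> (real ^ 'n) set" where
  "fixed g = {v. act g v = v}"

definition moved :: "'a \<Rightarrow> (real ^ 'n) set" where
  "moved g = range (\<lambda>v. act g v - v)"

lemma linear_act_minus: "g \<in> carrier W \<Longrightarrow> linear (\<lambda>v. act g v - v)"
  by (intro linear_compose_sub act_linear linear_ident)

lemma subspace_fixed: "g \<in> carrier W \<Longrightarrow> subspace (fixed g)"
  using linear_subspace_kernel[OF linear_act_minus] by (simp add: fixed_def)

lemma subspace_moved: "g \<in> carrier W \<Longrightarrow> subspace (moved g)"
  unfolding moved_def by (intro linear_subspace_image linear_act_minus) simp_all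

lemma refls_cases:
  assumes "t \<in> refls"
  obtains h i where "h \<in> carrier W" "i \<in> I" "t = inv h \<otimes> s i \<otimes> h"
  using assms by (auto simp: reflections_def)

lemma conj_simple_in_refls: "\<lbrakk>h \<in> carrier W; i \<in> I\<rbrakk> \<Longrightarrow> inv h \<otimes> s i \<otimes> h \<in> refls"
  by (auto simp: reflections_def)

lemma refls_closed [simp]: "t \<in> refls \<Longrightarrow> t \<in> carrier W"
  by (erule refls_cases) simp

lemma finite_refls: "finite refls"
  by (rule finite_subset[OF _ finite_carrier]) auto

lemma refl_square: "t \<in> refls \<Longrightarrow> t \<otimes> t = \<one>"
proof (erule refls_cases)
  fix h i assume h: "h \<in> carrier W" "i \<in> I" and t: "t = inv h \<otimes> s i \<otimes> h"
  show ?thesis unfolding t using h by (simp add: m_assoc)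
qed

text \<open>The root of \<open>h\<^sup>-\<^sup>1 s\<^sub>i h\<close> is the image of the simple root under \<open>h\<^sup>-\<^sup>1\<close>.\<close>

lemma act_refl:
  assumes "t \<in> refls"
  obtains \<beta> where "\<beta> \<noteq> 0" "\<And>v. act t v = v - (2 * ip \<beta> v / ip \<beta> \<beta>) *\<^sub>R \<beta>"
proof -
  obtain h i where h: "h \<in> carrier W" "i \<in> I" and t: "t = inv h \<otimes> s i \<otimes> h"
    using assms by (rule refls_cases)
  define \<beta> where "\<beta> = act (inv h) (simple_root i)"
  have act\<beta>: "act h \<beta> = simple_root i" using h by (simp add: \<beta>_def)
  then have nz: "\<beta> \<noteq> 0"
    using linear_0[OF act_linear[OF h(1)]] by (auto simp: axis_eq_0_iff)
  have "act t v = v - (2 * ip \<beta> v / ip \<beta> \<beta>) *\<^sub>R \<beta>" for v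
  proof -
    have "form (simple_root i) (act h v) = ip \<beta> v / ip \<beta> \<beta>"
      using ip_simple_root[OF h(2), of "act h v"] ip_act[OF h(1), of \<beta> v]
        ip_act[OF h(1), of \<beta> \<beta>] nz
      by (simp add: act\<beta> eq_divide_eq mult.commute)
    then have "act t v = act (inv h) (act h v - (2 * ip \<beta> v / ip \<beta> \<beta>) *\<^sub>R simple_root i)"
      using h by (simp add: t act_s)
    also have "\<dots> = v - (2 * ip \<beta> v / ip \<beta> \<beta>) *\<^sub>R \<beta>"
      using h act_linear[of "inv h"] by (simp add: linear_diff linear_scale \<beta>_def)
    finally show ?thesis .
  qed
  with nz show thesis by (rule that)
qed

text \<open>Move \<open>v\<close> into the closed fundamental chamber by choosing the highest point \<open>u\<close> of its
  orbit; then \<open>u\<close> is fixed by a conjugate \<open>g'\<close> of \<open>g\<close>. If \<open>u\<close> is on a wall of the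
  chamber, the reflection in that wall yields \<open>t\<close>. An interior \<open>u\<close> has positive inner product
  with all simple roots, which contradicts that \<open>g'\<close> makes some simple root negative.\<close>

lemma fixed_point_on_mirror:
  assumes g: "g \<in> carrier W" "g \<noteq> \<one>" and v: "act g v = v"
  obtains t where "t \<in> refls" "act t v = v"
proof -
  define height :: "real ^ 'n \<Rightarrow> real" where "height x = (\<Sum>i\<in>I. x $ i)" for x
  define M where "M = Max ((\<lambda>h. height (act h v)) ` carrier W)"
  have "M \<in> (\<lambda>h. height (act h v)) ` carrier W"
    unfolding M_def using finite_carrier one_closed by (intro Max_in) auto
  then obtain h where h: "h \<in> carrier W" "M = height (act h v)" by auto
  have max: "height (act k v) \<le> height (act h v)" if "k \<in> carrier W" for k
    using that finite_carrier unfolding h(2)[symmetric] M_def by (intro Max_ge) auto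
  define u where "u = act h v"
  \<comment> \<open>A simple reflection subtracts from \<open>u\<close> a multiple of a root of height \<open>1\<close>.\<close>
  have dominant: "form (simple_root i) u \<ge> 0" if i: "i \<in> I" for i
  proof -
    have "height (act (s i) u) = height u - 2 * form (simple_root i) u * height (simple_root i)"
      using i by (simp add: act_s height_def sum_subtractf sum_distrib_left)
    moreover have "height (simple_root i) = 1"
      using i by (simp add: height_def axis_def)
    moreover have "height (act (s i) u) \<le> height u"
      using max[of "s i \<otimes> h"] i h by (simp add: u_def)
    ultimately show ?thesis by simp
  qed
  show thesis
  proof (cases "\<exists>i\<in>I. form (simple_root i) u = 0")
    case True
    then obtain i where i: "i \<in> I" "form (simple_root i) u = 0" by blast
    then have "act (s i) u = u" by (simp add: act_s)
    then have "act (inv h \<otimes> s i \<otimes> h) v = v"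
      using i h by (simp add: u_def)
    with conj_simple_in_refls[OF h(1) i(1)] show thesis by (rule that)
  next
    case False
    define g' where "g' = h \<otimes> g \<otimes> inv h"
    have g': "g' \<in> carrier W" using g h by (simp add: g'_def)
    have "g' \<noteq> \<one>"
    proof
      assume "g' = \<one>"
      moreover have "inv h \<otimes> g' \<otimes> h = g" using g h by (simp add: g'_def m_assoc)
      ultimately show False using g h by simp
    qed
    then obtain i where i: "i \<in> I" and neg: "\<And>k. act g' (simple_root i) $ k \<le> 0"
      using negative_simple_root_image[OF g'] by blast
    define r where "r = act g' (simple_root i)"
    have "simple_root i \<in> tits_space I" using i by (auto simp: tits_space_def axis_def)
    then have "r \<in> tits_space I"
      unfolding r_def by (rule tits_rep_space[OF coxeter_system g'])
    then have r: "r = (\<Sum>j\<in>I. r $ j *\<^sub>R simple_root j)"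
      by (auto simp: tits_space_def vec_eq_iff axis_def if_distrib[of "(*) _"] cong: if_cong)
    have pos: "ip u (simple_root j) > 0" if "j \<in> I" for j
      using simple_root_form_pos_iff[OF that, of u] dominant[OF that] False that
      by (auto simp: ip_commute[of u] less_le)
    have "act g' u = u" using g h v by (simp add: g'_def u_def)
    then have "ip u (simple_root i) = ip u r"
      using ip_act[OF g', of u "simple_root i"] by (simp add: r_def)
    also have "\<dots> = (\<Sum>j\<in>I. r $ j * ip u (simple_root j))"
      by (subst r) (simp add: ip_sum_right)
    also have "\<dots> \<le> 0"
      using neg pos by (intro sum_nonpos mult_nonpos_nonneg) (auto simp: r_def less_imp_le)
    finally show thesis using pos[OF i] by simp
  qed
qed

lemma fixed_subset_mirror:
  assumes "g \<in> carrier W" "g \<noteq> \<one>"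
  obtains t where "t \<in> refls" "fixed g \<subseteq> fixed t"
proof -
  have "\<exists>t\<in>refls. fixed g \<subseteq> fixed t"
  proof (rule ccontr)
    assume "\<not> ?thesis"
    then have "\<exists>v\<in>fixed g. \<forall>A\<in>fixed ` refls. v \<notin> A"
      using finite_refls assms
      by (intro subspace_avoids_finite_union) (auto intro: subspace_fixed)
    then obtain v where v: "act g v = v" "\<And>t. t \<in> refls \<Longrightarrow> act t v \<noteq> v"
      by (auto simp: fixed_def)
    from fixed_point_on_mirror[OF assms v(1)] v(2) show False by blast
  qed
  then show thesis using that by blast
qed


section \<open>Reflection length is the codimension of the fixed space\<close>

definition codim :: "'a \<Rightarrow> nat" where
  "codim g = CARD('n) - dim (fixed g)"

lemma codim_add_dim: "codim g + dim (fixed g) = CARD('n)"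
  using dim_subset_UNIV[of "fixed g"] by (simp add: codim_def)

lemma codim_one [simp]: "codim \<one> = 0"
  by (simp add: codim_def fixed_def)

lemma fixed_Int_subset_mult:
  "\<lbrakk>g \<in> carrier W; h \<in> carrier W\<rbrakk> \<Longrightarrow> fixed g \<inter> fixed h \<subseteq> fixed (g \<otimes> h)"
  by (auto simp: fixed_def)

lemma dim_fixed_sum:
  assumes "g \<in> carrier W" "h \<in> carrier W"
  shows "dim {u + v |u v. u \<in> fixed g \<and> v \<in> fixed h} + dim (fixed g \<inter> fixed h)
    = dim (fixed g) + dim (fixed h)"
  using assms by (intro dim_sums_Int subspace_fixed)

lemma codim_mult_le:
  assumes "g \<in> carrier W" "h \<in> carrier W"
  shows "codim (g \<otimes> h) \<le> codim g + codim h"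
proof -
  have "dim (fixed g \<inter> fixed h) \<le> dim (fixed (g \<otimes> h))"
    using fixed_Int_subset_mult[OF assms] by (rule dim_subset)
  then show ?thesis
    using dim_fixed_sum[OF assms] codim_add_dim[of g] codim_add_dim[of h]
      codim_add_dim[of "g \<otimes> h"] dim_subset_UNIV[of "{u + v |u v. u \<in> fixed g \<and> v \<in> fixed h}"]
    by simp
qed

text \<open>The mirror and the root together span the space.\<close>

lemma codim_refl_le:
  assumes "t \<in> refls"
  shows "codim t \<le> 1"
proof -
  obtain \<beta> where \<beta>: "\<beta> \<noteq> 0" "\<And>v. act t v = v - (2 * ip \<beta> v / ip \<beta> \<beta>) *\<^sub>R \<beta>"
    using act_refl[OF assms] by blast
  have "UNIV = {u + v |u v. u \<in> fixed t \<and> v \<in> span {\<beta>}}"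
  proof -
    have "\<exists>u v. x = u + v \<and> u \<in> fixed t \<and> v \<in> span {\<beta>}" for x
    proof (intro exI conjI)
      let ?c = "ip \<beta> x / ip \<beta> \<beta>"
      show "x = (x - ?c *\<^sub>R \<beta>) + ?c *\<^sub>R \<beta>" by simp
      show "x - ?c *\<^sub>R \<beta> \<in> fixed t" using \<beta> by (simp add: fixed_def)
      show "?c *\<^sub>R \<beta> \<in> span {\<beta>}" by (intro span_scale span_base) simp
    qed
    then show ?thesis by blast
  qed
  then have "CARD('n) = dim {u + v |u v. u \<in> fixed t \<and> v \<in> span {\<beta>}}"
    using dim_UNIV[where 'a = "real ^ 'n"] by simp
  also have "\<dots> \<le> dim (fixed t) + dim (span {\<beta>})"
    using dim_sums_Int[OF subspace_fixed[of t] subspace_span[of "{\<beta>}"]] assms by simp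
  also have "dim (span {\<beta>}) \<le> 1"
    by (simp add: dim_singleton)
  finally show ?thesis using codim_add_dim[of t] by simp
qed

lemma codim_list_mult_le: "set ts \<subseteq> refls \<Longrightarrow> codim (list_mult W ts) \<le> length ts"
proof (induction ts)
  case (Cons t ts)
  have "list_mult W ts \<in> carrier W"
    using Cons.prems by (intro list_mult_closed[OF is_group]) auto
  then have "codim (list_mult W (t # ts)) \<le> codim t + codim (list_mult W ts)"
    using Cons.prems codim_mult_le by (simp add: list_mult_def)
  also have "\<dots> \<le> 1 + length ts"
    using Cons codim_refl_le by (intro add_mono) auto
  finally show ?case by simp
qed (simp add: list_mult_def)

text \<open>The images of \<open>g - 1\<close> and \<open>h - 1\<close> are the orthogonal complements of the fixed spaces,
  and taking complements reverses inclusions.\<close>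

lemma moved_mono:
  assumes g: "g \<in> carrier W" and h: "h \<in> carrier W" and sub: "fixed h \<subseteq> fixed g"
  shows "moved g \<subseteq> moved h"
proof
  have orth: "ip u f = 0" if k: "k \<in> carrier W" and u: "u \<in> moved k" and f: "f \<in> fixed k" for u f k
  proof -
    obtain v where v: "u = act k v - v" using u by (auto simp: moved_def)
    have "ip (act k v) f = ip v f" using ip_act[OF k, of v f] f by (simp add: fixed_def)
    then show ?thesis by (simp add: v)
  qed
  let ?S = "{a + f |a f. a \<in> moved h \<and> f \<in> fixed h}"
  have "moved h \<inter> fixed h \<subseteq> {0}" using orth[OF h] by fastforce
  then have "dim (moved h \<inter> fixed h) = 0" by (simp add: dim_eq_0)
  moreover have "dim (moved h) + dim (fixed h) = CARD('n)"
    using dim_range_add_dim_kernel[OF linear_act_minus[OF h]] by (simp add: moved_def fixed_def)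
  ultimately have "dim ?S = CARD('n)"
    using dim_sums_Int[OF subspace_moved[OF h] subspace_fixed[OF h]] by linarith
  then have S: "?S = UNIV"
    using subspace_sums[OF subspace_moved[OF h] subspace_fixed[OF h]] by (intro subspace_eq_UNIV)
  fix u assume u: "u \<in> moved g"
  then obtain a f where af: "u = a + f" "a \<in> moved h" "f \<in> fixed h"
    using S by blast
  have "ip u f = 0" using orth[OF g u] af sub by blast
  moreover have "ip a f = 0" using orth[OF h] af by blast
  ultimately have "ip f f = 0" using af(1) by simp
  then show "u \<in> moved h" using af by simp
qed

text \<open>Carter's argument: a root of the form \<open>g v - v\<close> defines the reflection that exchanges
  \<open>v\<close> and \<open>g v\<close>.\<close>

lemma refl_lowers_codim:
  assumes g: "g \<in> carrier W" "g \<noteq> \<one>"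
  obtains t where "t \<in> refls" "codim (t \<otimes> g) < codim g"
proof -
  obtain t where t: "t \<in> refls" and sub: "fixed g \<subseteq> fixed t"
    using fixed_subset_mirror[OF g] by blast
  obtain \<beta> where \<beta>: "\<beta> \<noteq> 0" "\<And>v. act t v = v - (2 * ip \<beta> v / ip \<beta> \<beta>) *\<^sub>R \<beta>"
    using act_refl[OF t] by blast
  \<comment> \<open>The point at half a root in negative direction is moved by exactly the root.\<close>
  define v0 where "v0 = (- 1 / 2) *\<^sub>R \<beta>"
  have "act t v0 - v0 = \<beta>"
    unfolding \<beta>(2) v0_def using \<beta>(1) by simp
  then have "\<beta> \<in> moved t" unfolding moved_def by (auto intro!: image_eqI[of _ _ v0])
  then have "\<beta> \<in> moved g" using moved_mono[of t g] t g sub by auto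
  then obtain v where v: "\<beta> = act g v - v" by (auto simp: moved_def)
  then have gv: "act g v = v + \<beta>" by simp
  have "ip (v + \<beta>) (v + \<beta>) = ip v v" using ip_act[OF g(1), of v v] gv by simp
  then have "2 * ip \<beta> (v + \<beta>) = ip \<beta> \<beta>" by (simp add: ip_commute[of v \<beta>])
  then have "act t (act g v) = v" using \<beta>(1) by (simp add: gv \<beta>(2) del: ip_simps)
  then have "v \<in> fixed (t \<otimes> g)" using t g by (simp add: fixed_def)
  moreover have "v \<notin> fixed g" using gv \<beta>(1) by (simp add: fixed_def)
  moreover have "fixed g \<subseteq> fixed (t \<otimes> g)"
    using fixed_Int_subset_mult[of t g] sub t g by auto
  ultimately have "fixed g \<subset> fixed (t \<otimes> g)" by blast
  then have "dim (fixed g) < dim (fixed (t \<otimes> g))"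
    using subspace_fixed[of g] subspace_fixed[of "t \<otimes> g"] t g
    by (intro dim_psubset) (simp add: span_eq_iff[THEN iffD2])
  then have "codim (t \<otimes> g) < codim g"
    using codim_add_dim[of g] codim_add_dim[of "t \<otimes> g"] by simp
  with t show thesis by (rule that)
qed

lemma refl_factorization:
  assumes "g \<in> carrier W"
  shows "\<exists>ts. set ts \<subseteq> refls \<and> length ts \<le> codim g \<and> list_mult W ts = g"
  using assms
proof (induction "codim g" arbitrary: g rule: less_induct)
  case less
  show ?case
  proof (cases "g = \<one>")
    case True
    then show ?thesis by (intro exI[of _ "[]"]) (simp add: list_mult_def)
  next
    case False
    obtain t where t: "t \<in> refls" "codim (t \<otimes> g) < codim g"
      using refl_lowers_codim[OF less.prems False] by blast
    then obtain ts where ts: "set ts \<subseteq> refls" "length ts \<le> codim (t \<otimes> g)"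
        "list_mult W ts = t \<otimes> g"
      using less.hyps[of "t \<otimes> g"] less.prems by auto
    have "list_mult W (t # ts) = (t \<otimes> t) \<otimes> g"
      using t ts less.prems by (simp add: list_mult_def m_assoc)
    then show ?thesis
      using t ts less.prems refl_square[OF t(1)] by (intro exI[of _ "t # ts"]) auto
  qed
qed

theorem reflection_length_eq_codim:
  assumes "g \<in> carrier W"
  shows "reflection_length W (s ` I) g = codim g"
  unfolding reflection_length_def
proof (rule Least_equality)
  obtain ts where ts: "set ts \<subseteq> refls" "length ts \<le> codim g" "list_mult W ts = g"
    using refl_factorization[OF assms] by blast
  then have "length ts = codim g" using codim_list_mult_le[of ts] by simp
  then show "\<exists>ts. set ts \<subseteq> refls \<and> length ts = codim g \<and> list_mult W ts = g"
    using ts by blast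
qed (use codim_list_mult_le in auto)

lemma codim_0_imp_one:
  assumes "g \<in> carrier W" "codim g = 0"
  shows "g = \<one>"
  using refl_lowers_codim[OF assms(1)] assms(2) by fastforce

lemma absolute_le_iff:
  "\<lbrakk>x \<in> carrier W; y \<in> carrier W\<rbrakk> \<Longrightarrow>
    absolute_le W (s ` I) x y \<longleftrightarrow> codim y = codim x + codim (inv x \<otimes> y)"
  by (simp add: absolute_le_def reflection_length_eq_codim)

lemma absolute_le_antisym:
  assumes x: "x \<in> carrier W" and y: "y \<in> carrier W"
    and "absolute_le W (s ` I) x y" "absolute_le W (s ` I) y x"
  shows "x = y"
proof -
  have "codim (inv x \<otimes> y) = 0" using assms by (simp add: absolute_le_iff)
  then have "inv x \<otimes> y = \<one>" using x y by (intro codim_0_imp_one) auto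
  then have "x \<otimes> (inv x \<otimes> y) = x" using x by simp
  then show ?thesis using x y by (simp add: m_assoc[symmetric])
qed


section \<open>The absolute order below an element\<close>

text \<open>Additivity of codimensions leaves no slack in the inequality
  \<open>codim (g \<otimes> h) \<le> codim g + codim h\<close>: the two fixed spaces are in general position.\<close>

lemma fixed_mult_eq_Int:
  assumes "g \<in> carrier W" "h \<in> carrier W" "codim (g \<otimes> h) = codim g + codim h"
  shows "fixed (g \<otimes> h) = fixed g \<inter> fixed h"
    and "{u + v |u v. u \<in> fixed g \<and> v \<in> fixed h} = UNIV"
proof -
  let ?S = "{u + v |u v. u \<in> fixed g \<and> v \<in> fixed h}"
  note sub = subspace_fixed[OF assms(1)] subspace_fixed[OF assms(2)]
  have le: "dim ?S \<le> CARD('n)" "dim (fixed g \<inter> fixed h) \<le> dim (fixed (g \<otimes> h))"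
    using dim_subset_UNIV[of ?S] dim_subset[OF fixed_Int_subset_mult[OF assms(1,2)]] by simp_all
  have eq: "dim ?S = CARD('n)" "dim (fixed (g \<otimes> h)) \<le> dim (fixed g \<inter> fixed h)"
    using le dim_fixed_sum[OF assms(1,2)] codim_add_dim[of g] codim_add_dim[of h]
      codim_add_dim[of "g \<otimes> h"] assms(3) by simp_all
  show "fixed (g \<otimes> h) = fixed g \<inter> fixed h"
    using eq(2) assms sub fixed_Int_subset_mult[OF assms(1,2)]
    by (intro subspace_dim_equal[symmetric] subspace_fixed subspace_inter) auto
  show "?S = UNIV"
    using eq(1) subspace_sums[OF sub] by (intro subspace_eq_UNIV)
qed

text \<open>As \<open>Fix(g) + Fix(h)\<close> is the whole space, \<open>g - 1\<close> reaches its image already on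
  \<open>Fix(h)\<close>, and there \<open>g\<close> agrees with \<open>g h\<close>.\<close>

lemma moved_eq_image_fixed:
  assumes "g \<in> carrier W" "h \<in> carrier W" "codim (g \<otimes> h) = codim g + codim h"
  shows "moved g = (\<lambda>v. act (g \<otimes> h) v - v) ` fixed h"
proof
  show "(\<lambda>v. act (g \<otimes> h) v - v) ` fixed h \<subseteq> moved g"
    using assms by (auto simp: moved_def fixed_def)
  show "moved g \<subseteq> (\<lambda>v. act (g \<otimes> h) v - v) ` fixed h"
    unfolding moved_def
  proof clarify
    fix x
    obtain u v where uv: "x = u + v" "u \<in> fixed g" "v \<in> fixed h"
      using fixed_mult_eq_Int(2)[OF assms] by blast
    then have "act g x - x = act (g \<otimes> h) v - v"
      using assms by (simp add: fixed_def linear_add[OF act_linear])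
    then show "act g x - x \<in> (\<lambda>v. act (g \<otimes> h) v - v) ` fixed h"
      using uv(3) by blast
  qed
qed

text \<open>For the converse direction it has to be shown that \<open>c = x\<^sup>-\<^sup>1 y\<close> fixes a large space. It
  fixes \<open>Fix(y)\<close>, since \<open>x\<close> and \<open>y\<close> both do, and it fixes \<open>Fix(a)\<close>, since there
  \<open>x\<close> and \<open>y\<close> both agree with \<open>w\<close>. The intersection of the two is contained in
  \<open>Fix(w)\<close>, so their sum has codimension at most \<open>codim y - codim x\<close>.\<close>

theorem absolute_le_iff_fixed_subset:
  assumes w: "w \<in> carrier W" and x: "x \<in> carrier W" and y: "y \<in> carrier W"
    and xw: "absolute_le W (s ` I) x w" and yw: "absolute_le W (s ` I) y w"
  shows "absolute_le W (s ` I) x y \<longleftrightarrow> fixed y \<subseteq> fixed x"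
proof
  assume "absolute_le W (s ` I) x y"
  moreover have "x \<otimes> (inv x \<otimes> y) = y" using x y by (simp add: m_assoc[symmetric])
  ultimately show "fixed y \<subseteq> fixed x"
    using fixed_mult_eq_Int(1)[of x "inv x \<otimes> y"] x y by (auto simp: absolute_le_iff)
next
  assume sub: "fixed y \<subseteq> fixed x"
  define a b c where "a = inv x \<otimes> w" and "b = inv y \<otimes> w" and "c = inv x \<otimes> y"
  have abc: "a \<in> carrier W" "b \<in> carrier W" "c \<in> carrier W"
    using w x y by (simp_all add: a_def b_def c_def)
  have prods: "x \<otimes> a = w" "y \<otimes> b = w" "x \<otimes> c = y"
    using w x y by (simp_all add: a_def b_def c_def m_assoc[symmetric])
  have lx: "codim w = codim x + codim a" and ly: "codim w = codim y + codim b"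
    using xw yw w x y by (simp_all add: absolute_le_iff a_def b_def)
  have fw: "fixed w = fixed y \<inter> fixed b"
    using fixed_mult_eq_Int(1)[OF y abc(2)] ly by (simp add: prods)
  have "fixed a \<subseteq> fixed b"
  proof
    fix v assume v: "v \<in> fixed a"
    \<comment> \<open>What \<open>w\<close> adds to \<open>v\<close> lies in \<open>moved x\<close>, hence in \<open>moved y\<close>; so it adds the same to some \<open>v' \<in> fixed b\<close>.\<close>
    have "moved x = (\<lambda>v. act w v - v) ` fixed a" "moved y = (\<lambda>v. act w v - v) ` fixed b"
      using moved_eq_image_fixed[OF x abc(1)] moved_eq_image_fixed[OF y abc(2)] lx ly
      by (simp_all add: prods)
    then obtain v' where v': "v' \<in> fixed b" "act w v - v = act w v' - v'"
      using moved_mono[OF x y sub] v by blast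
    then have "act w (v - v') = v - v'"
      by (simp add: linear_diff[OF act_linear[OF w]] algebra_simps)
    then have "v - v' \<in> fixed w" by (simp add: fixed_def)
    then have "v - v' \<in> fixed b" using fw by blast
    then have "(v - v') + v' \<in> fixed b"
      using v' subspace_fixed[OF abc(2)] by (intro subspace_add)
    then show "v \<in> fixed b" by simp
  qed
  have "fixed a \<subseteq> fixed c"
  proof
    fix v assume v: "v \<in> fixed a"
    then have "v \<in> fixed b" using \<open>fixed a \<subseteq> fixed b\<close> by blast
    moreover have "act w v = act x (act a v)" "act w v = act y (act b v)"
      using x y abc prods by (metis act_mult)+
    ultimately have "act x v = act y v" using v by (simp add: fixed_def)
    then have "act (inv x) (act y v) = v" using x by (metis act_inv_act)
    then show "v \<in> fixed c" using x y by (simp add: fixed_def c_def)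
  qed
  moreover have "fixed y \<subseteq> fixed c"
  proof
    fix v assume v: "v \<in> fixed y"
    then have "act y v = v" "act x v = v" using sub by (auto simp: fixed_def)
    then show "v \<in> fixed c"
      using x y act_inv_act[OF x, of v] by (simp add: fixed_def c_def)
  qed
  ultimately have "{u + v |u v. u \<in> fixed a \<and> v \<in> fixed y} \<subseteq> fixed c"
    using subspace_fixed[OF abc(3)] by (auto intro: subspace_add)
  then have "dim {u + v |u v. u \<in> fixed a \<and> v \<in> fixed y} \<le> dim (fixed c)"
    by (rule dim_subset)
  moreover have "dim (fixed a \<inter> fixed y) \<le> dim (fixed w)"
    using fw \<open>fixed a \<subseteq> fixed b\<close> by (intro dim_subset) auto
  ultimately have "codim c + codim x \<le> codim y"
    using dim_fixed_sum[OF abc(1) y] codim_add_dim[of a] codim_add_dim[of c]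
      codim_add_dim[of y] codim_add_dim[of w] lx by simp
  moreover have "codim y \<le> codim x + codim c"
    using codim_mult_le[OF x abc(3)] by (simp add: prods)
  ultimately show "absolute_le W (s ` I) x y"
    using x y by (simp add: absolute_le_iff c_def)
qed

text \<open>The part of a vector outside the coordinates in \<open>I\<close> is fixed by all of \<open>W\<close>, so both
  inclusions only concern the part in the space of the Tits representation.\<close>

lemma Fix_subset_iff:
  assumes x: "x \<in> carrier W" and y: "y \<in> carrier W"
  shows "Fix W I s m y \<subseteq> Fix W I s m x \<longleftrightarrow> fixed y \<subseteq> fixed x"
proof
  assume sub: "Fix W I s m y \<subseteq> Fix W I s m x"
  show "fixed y \<subseteq> fixed x"
  proof
    fix v assume v: "v \<in> fixed y"
    define v1 v2 :: "real ^ 'n"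
      where "v1 = (\<chi> i. if i \<in> I then v $ i else 0)" and "v2 = (\<chi> i. if i \<in> I then 0 else v $ i)"
    have v12: "v = v1 + v2" by (simp add: v1_def v2_def vec_eq_iff)
    have v2: "act g v2 = v2" if g: "g \<in> carrier W" for g
    proof -
      obtain u where u: "u \<in> lists I" "word u = g" using g by (rule reduced_word_exists)
      from u(1) have "act (word u) v2 = v2"
        by (induction u) (auto simp: act_s tits_form_axis v2_def)
      with u(2) show ?thesis by simp
    qed
    have "act y v1 = v1"
      using v v2[OF y] linear_add[OF act_linear[OF y], of v1 v2] by (simp add: fixed_def v12)
    then have "v1 \<in> Fix W I s m y" by (simp add: Fix_def tits_space_def v1_def)
    then have "act x v1 = v1" using sub by (auto simp: Fix_def)
    then show "v \<in> fixed x"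
      using v2[OF x] linear_add[OF act_linear[OF x], of v1 v2] by (simp add: fixed_def v12)
  qed
qed (auto simp: Fix_def fixed_def)

end

section \<open>The anti-isomorphism\<close>

text \<open>That \<open>leA\<close> is a partial order and that \<open>f\<close> is injective both follow from the
  characterization of \<open>leA\<close> by inclusion together with antisymmetry.\<close>

lemma poset_anti_isomorphism_if_reverses:
  assumes iff: "\<And>x y. \<lbrakk>x \<in> A; y \<in> A\<rbrakk> \<Longrightarrow> leA x y \<longleftrightarrow> f y \<subseteq> f x"
    and antisym: "\<And>x y. \<lbrakk>x \<in> A; y \<in> A; leA x y; leA y x\<rbrakk> \<Longrightarrow> x = y"
  shows "poset_anti_isomorphism A leA (f ` A) (\<subseteq>) f"
proof -
  have inj: "inj_on f A"
  proof (rule inj_onI)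
    fix x y assume "x \<in> A" "y \<in> A" "f x = f y"
    then show "x = y" using iff[of x y] iff[of y x] antisym by simp
  qed
  have "poset_on A leA"
    unfolding poset_on_def
  proof (intro conjI)
    show "reflp_on A leA" by (rule reflp_onI) (simp add: iff)
    show "transp_on A leA" by (rule transp_onI) (auto simp: iff)
    show "antisymp_on A leA" by (rule antisymp_onI) (rule antisym)
  qed
  moreover have "poset_on (f ` A) (\<subseteq>)"
    unfolding poset_on_def reflp_on_def transp_on_def antisymp_on_def by blast
  moreover have "monotone_on (f ` A) (\<subseteq>) (\<lambda>a b. leA b a) (inv_into A f)"
    using iff inj by (auto simp: monotone_on_def)
  ultimately show ?thesis
    using iff inj by (auto simp: poset_anti_isomorphism_def bij_betw_def monotone_on_def)
qed

theorem proposition2p8: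
  fixes W :: "('a, 'b) monoid_scheme"
    and I :: "'n::finite set" and s :: "'n \<Rightarrow> 'a" and m :: "'n \<Rightarrow> 'n \<Rightarrow> nat" and w :: 'a
  assumes "coxeter_system W I s m"
    and "finite (carrier W)"
    and "quasi_coxeter W (s ` I) w"
  shows "poset_anti_isomorphism
           (absolute_interval W (s ` I) w) (absolute_le W (s ` I))
           (Fix W I s m ` absolute_interval W (s ` I) w) (\<subseteq>)
           (Fix W I s m)"
proof -
  interpret finite_coxeter W I s m
    using assms by unfold_locales
  have w: "w \<in> carrier W"
    using assms(3) by (simp add: quasi_coxeter_def)
  show ?thesis
    using absolute_le_iff_fixed_subset[OF w] absolute_le_antisym Fix_subset_iff
    by (intro poset_anti_isomorphism_if_reverses) (auto simp: absolute_interval_def)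
qed

end
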